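(* For every $k\ge3$, the self-similar structure $(K^{(k)},\mathsf{X}_k,\{F_i\}_{i\in\mathsf{X}_k})$ is post critically finite.
   Context: Let $\mathsf{X}_k=\{0,\dots,k-1\}$. Let $p_0,\dots,p_{k-1}$ be the vertices of a regular simplex in $\mathbb{R}^{k-1}$ (with $k$ vertices), and let $q_i=\frac1{k-1}\sum_{j\neq i}p_j$. For $i\in\mathsf{X}_k$ let $F_i:\mathbb{R}^{k-1}\to\mathbb{R}^{k-1}$ be the unique affine map with $F_i(p_i)=p_i$ and $F_i(p_j)=q_j$ for $j\ne i$; each $F_i$ is a contraction for the Euclidean metric. $K^{(k)}$ is the unique nonempty compact set with $K^{(k)}=\bigcup_{i\in\mathsf{X}_k}F_i(K^{(k)})$. For a finite set $S$, the shift space $\Sigma(S)=S^{-\omega}$ is the space of left-infinite sequences $\ldots x_2x_1$ of elements of $S$ with the product topology; for $s\in S$ write $s(\ldots x_2x_1)=\ldots x_2x_1s$, and let $\sigma(\ldots x_3x_2x_1)=\ldots x_3x_2$ be the shift. A self-similar structure $(K,S,\{F_s\}_{s\in S})$ consists of a compact metric space $K$ and continuous injections $F_s:K\to K$ such that there is a continuous surjection $\pi:\Sigma(S)\to K$ with $\pi\circ s=F_s\circ\pi$ for all $s\in S$ (for $K^{(k)}$, $\pi(\ldots x_2x_1)$ is the unique point of $\bigcap_{m\ge1}F_{x_1}\circ\cdots\circ F_{x_m}(K^{(k)})$). Its critical set is $\mathcal{C}=\pi^{-1}\bigl(\bigcup_{i,j\in S,\,i\ne j}(F_i(K)\cap F_j(K))\bigr)$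 and its post critical set is $\mathcal{P}=\bigcup_{n\ge1}\sigma^n(\mathcal{C})$. The structure is post critically finite if $\mathcal{P}$ is finite. *)

theory Defs
  imports "HOL-Analysis.Analysis"
begin

(* A left-infinite word ... x_2 x_1 is encoded as the function w with w n = x_(n+1), so that
   index 0 is the rightmost letter. *)

definition shift_space :: "'s set \<Rightarrow> (nat \<Rightarrow> 's) topology" where
  "shift_space S = product_topology (\<lambda>_. discrete_topology S) UNIV"

definition append_letter :: "'s \<Rightarrow> (nat \<Rightarrow> 's) \<Rightarrow> nat \<Rightarrow> 's" where
  "append_letter s w = case_nat s w"

definition shift :: "(nat \<Rightarrow> 's) \<Rightarrow> nat \<Rightarrow> 's" where
  "shift w = (\<lambda>n. w (Suc n))"

definition coding_map ::
    "'a::metric_space set \<Rightarrow> 's set \<Rightarrow> ('s \<Rightarrow> 'a \<Rightarrow> 'a) \<Rightarrow> ((nat \<Rightarrow> 's) \<Rightarrow> 'a) \<Rightarrow> bool" where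
  "coding_map K S F \<pi> \<longleftrightarrow>
     continuous_map (shift_space S) (top_of_set K) \<pi> \<and>
     \<pi> ` topspace (shift_space S) = K \<and>
     (\<forall>s\<in>S. \<forall>w\<in>topspace (shift_space S). \<pi> (append_letter s w) = F s (\<pi> w))"

definition self_similar_structure ::
    "'a::metric_space set \<Rightarrow> 's set \<Rightarrow> ('s \<Rightarrow> 'a \<Rightarrow> 'a) \<Rightarrow> bool" where
  "self_similar_structure K S F \<longleftrightarrow>
     compact K \<and> finite S \<and>
     (\<forall>s\<in>S. F s ` K \<subseteq> K \<and> continuous_on K (F s) \<and> inj_on (F s) K) \<and>
     (\<exists>\<pi>. coding_map K S F \<pi>)"

definition critical_set ::
    "'a::metric_space set \<Rightarrow> 's set \<Rightarrow> ('s \<Rightarrow> 'a \<Rightarrow> 'a) \<Rightarrow> ((nat \<Rightarrow> 's) \<Rightarrow> 'a) \<Rightarrow> (nat \<Rightarrow> 's) set" where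
  "critical_set K S F \<pi> =
     {w \<in> topspace (shift_space S). \<pi> w \<in> (\<Union>i\<in>S. \<Union>j\<in>S - {i}. F i ` K \<inter> F j ` K)}"

definition post_critical_set ::
    "'a::metric_space set \<Rightarrow> 's set \<Rightarrow> ('s \<Rightarrow> 'a \<Rightarrow> 'a) \<Rightarrow> ((nat \<Rightarrow> 's) \<Rightarrow> 'a) \<Rightarrow> (nat \<Rightarrow> 's) set" where
  "post_critical_set K S F \<pi> = (\<Union>n\<in>{1..}. (shift ^^ n) ` critical_set K S F \<pi>)"

(* The coding map of a self-similar structure exists by definition and is unique on the shift
   space, its value at w being the only point of the intersection of the sets
   (F (w 0) o ... o F (w m)) ` K; so the quantifier over \<pi> ranges over a single map. *)

definition post_critically_finite ::
    "'a::metric_space set \<Rightarrow> 's set \<Rightarrow> ('s \<Rightarrow> 'a \<Rightarrow> 'a) \<Rightarrow> bool" where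
  "post_critically_finite K S F \<longleftrightarrow>
     self_similar_structure K S F \<and>
     (\<forall>\<pi>. coding_map K S F \<pi> \<longrightarrow> finite (post_critical_set K S F \<pi>))"

definition regular_simplex_vertices :: "nat \<Rightarrow> (nat \<Rightarrow> 'a::euclidean_space) \<Rightarrow> bool" where
  "regular_simplex_vertices k p \<longleftrightarrow>
     inj_on p {..<k} \<and> \<not> affine_dependent (p ` {..<k}) \<and>
     (\<exists>d. \<forall>i<k. \<forall>j<k. i \<noteq> j \<longrightarrow> dist (p i) (p j) = d)"

definition facet_barycenter :: "nat \<Rightarrow> (nat \<Rightarrow> 'a::euclidean_space) \<Rightarrow> nat \<Rightarrow> 'a" where
  "facet_barycenter k p i = (1 / (real k - 1)) *\<^sub>R (\<Sum>j\<in>{..<k} - {i}. p j)"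

definition affine_map :: "('a::real_vector \<Rightarrow> 'b::real_vector) \<Rightarrow> bool" where
  "affine_map f \<longleftrightarrow> (\<exists>L b. linear L \<and> f = (\<lambda>x. L x + b))"

definition simplex_map :: "nat \<Rightarrow> (nat \<Rightarrow> 'a::euclidean_space) \<Rightarrow> nat \<Rightarrow> 'a \<Rightarrow> 'a" where
  "simplex_map k p i =
     (THE f. affine_map f \<and> f (p i) = p i \<and>
             (\<forall>j<k. j \<noteq> i \<longrightarrow> f (p j) = facet_barycenter k p j))"

definition simplex_attractor :: "nat \<Rightarrow> (nat \<Rightarrow> 'a::euclidean_space) \<Rightarrow> 'a set" where
  "simplex_attractor k p =
     (THE K. K \<noteq> {} \<and> compact K \<and> K = (\<Union>i<k. simplex_map k p i ` K))"

end

theory Submission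
  imports Defs
begin

text \<open>Write \<open>x\<^sub>l\<close> for the barycentric coordinates of \<open>x\<close> with respect to the vertices. Then \<open>F\<^sub>i\<close> sends
  \<open>x\<close> to the point with coordinates \<open>x\<^sub>i + (1 - x\<^sub>i) / (k - 1)\<close> at \<open>i\<close> and \<open>(1 - x\<^sub>i - x\<^sub>l) / (k - 1)\<close> at
  \<open>l \<noteq> i\<close>. Everything about the pieces of the attractor is read off from this formula.

  Let \<open>x\<close> and \<open>y\<close> be points of the solid simplex with \<open>F\<^sub>i x = F\<^sub>j y\<close> and \<open>i \<noteq> j\<close>. In \<open>F\<^sub>i x\<close> the
  coordinate at \<open>i\<close> is at least every other one, and likewise for \<open>F\<^sub>j y\<close> and \<open>j\<close>; equality forces
  \<open>x\<^sub>i = x\<^sub>j = 0\<close> (\<open>overlap_bary_eq_0\<close>). If \<open>x\<close> also lies in the attractor, it is the image \<open>F\<^sub>l z\<close> of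
  a point \<open>z\<close> of the attractor. The coordinate of \<open>F\<^sub>l z\<close> at \<open>l\<close> is positive, so \<open>l\<close> is neither \<open>i\<close>
  nor \<open>j\<close>, and the two vanishing coordinates say \<open>z\<^sub>l + z\<^sub>i = 1 = z\<^sub>l + z\<^sub>j\<close>; hence \<open>z\<^sub>l = 1\<close> and \<open>x\<close> is the
  vertex \<open>p\<^sub>l\<close> (\<open>attractor_vertex_if_two_bary_eq_0\<close>). Two pieces therefore meet only in images of
  vertices. A vertex \<open>p\<^sub>l\<close> lies in no piece but the one of \<open>F\<^sub>l\<close>, which is injective and fixes it, so
  its only code is the constant word of \<open>l\<close> (\<open>code_of_vertex\<close>). Hence deleting the last letter of a critical code
  leaves a constant word, and the post critical set has at most \<open>k\<close> elements.

  That the attractor and its coding map exist is the general theory of finite systems of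
  contractions on a complete metric space (locale \<open>contracting_ifs\<close>): the coding map is the limit of
  the compositions \<open>F (w 0) \<circ> \<dots> \<circ> F (w (n - 1))\<close>, and the attractor is its image. This applies
  because on vectors \<open>\<Sum>\<^sub>l v\<^sub>l p\<^sub>l\<close> with \<open>\<Sum>\<^sub>l v\<^sub>l = 0\<close> the Euclidean norm of a regular simplex is a
  multiple of the Euclidean norm of the coefficients (\<open>norm_sq_combination_equidistant\<close>), for which
  the formula above is a contraction.\<close>

section \<open>Contracting iterated function systems\<close>

lemma topspace_shift_space: "topspace (shift_space S) = {w. range w \<subseteq> S}"
  by (auto simp: shift_space_def PiE_def Pi_def)

lemma shift_append_letter [simp]: "shift (append_letter s w) = w"
  by (auto simp: shift_def append_letter_def)

lemma append_letter_0 [simp]: "append_letter s w 0 = s"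
  by (simp add: append_letter_def)

lemma funpow_shift: "(shift ^^ n) w = (\<lambda>j. w (n + j))"
  by (induction n) (auto simp: shift_def)

lemma range_word:
  assumes "range w \<subseteq> S"
  shows "w n \<in> S" "range (shift w) \<subseteq> S" "range ((shift ^^ n) w) \<subseteq> S"
  using assms by (auto simp: shift_def funpow_shift)

lemma range_append_letter: "s \<in> S \<Longrightarrow> range w \<subseteq> S \<Longrightarrow> range (append_letter s w) \<subseteq> S"
  by (auto simp: append_letter_def image_subset_iff split: nat.splits)

primrec word_map :: "('s \<Rightarrow> 'a \<Rightarrow> 'a) \<Rightarrow> nat \<Rightarrow> (nat \<Rightarrow> 's) \<Rightarrow> 'a \<Rightarrow> 'a" where
  "word_map F 0 w x = x"
| "word_map F (Suc n) w x = F (w 0) (word_map F n (shift w) x)"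

lemma word_map_add:
  "word_map F (n + m) w x = word_map F n w (word_map F m ((shift ^^ n) w) x)"
  by (induction n arbitrary: w) (simp_all add: funpow_swap1)

lemma word_map_Suc_right: "word_map F (Suc n) w x = word_map F n w (F (w n) x)"
  using word_map_add[of F n 1 w x] by (simp add: funpow_shift)

lemma word_map_cong:
  "(\<And>j. j < n \<Longrightarrow> w j = w' j) \<Longrightarrow> word_map F n w x = word_map F n w' x"
proof (induction n arbitrary: w w')
  case (Suc n)
  have "word_map F n (shift w) x = word_map F n (shift w') x"
    using Suc.prems by (intro Suc.IH) (simp add: shift_def)
  then show ?case using Suc.prems[of 0] by simp
qed simp

locale contracting_ifs =
  fixes S :: "'s set" and F :: "'s \<Rightarrow> 'a \<Rightarrow> 'a::complete_space" and r :: real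
  assumes finite: "finite S" and nonempty: "S \<noteq> {}"
    and ratio: "0 \<le> r" "r < 1"
    and contraction: "s \<in> S \<Longrightarrow> dist (F s x) (F s y) \<le> r * dist x y"
begin

lemma ratio_power_null: "(\<lambda>n. r ^ n * c) \<longlonglongrightarrow> 0"
  using ratio by (intro tendsto_mult_left_zero LIMSEQ_power_zero) auto

lemma continuous: "s \<in> S \<Longrightarrow> continuous_on A (F s)"
  by (rule lipschitz_on_continuous_on[where L = r])
     (auto intro!: lipschitz_onI contraction ratio)

lemma word_map_contraction:
  assumes "range w \<subseteq> S"
  shows "dist (word_map F n w x) (word_map F n w y) \<le> r ^ n * dist x y"
  using assms
proof (induction n arbitrary: w)
  case (Suc n)
  have "dist (word_map F (Suc n) w x) (word_map F (Suc n) w y)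
      \<le> r * dist (word_map F n (shift w) x) (word_map F n (shift w) y)"
    using contraction range_word(1)[OF Suc.prems] by simp
  also have "\<dots> \<le> r * (r ^ n * dist x y)"
    using Suc.IH range_word(2)[OF Suc.prems] ratio by (intro mult_left_mono) auto
  finally show ?case by (simp only: power_Suc mult.assoc)
qed simp

text \<open>If every map moves \<open>x\<close> by at most \<open>D\<close>, then the ball of radius \<open>D / (1 - r)\<close> around \<open>x\<close>
  is mapped into itself by every map, so that no orbit of \<open>x\<close> leaves it.\<close>

lemma orbits_bounded:
  obtains R where "\<And>n w. range w \<subseteq> S \<Longrightarrow> dist (word_map F n w x) x \<le> R"
proof -
  define D where "D = Max ((\<lambda>s. dist (F s x) x) ` S)"
  have D: "dist (F s x) x \<le> D" if "s \<in> S" for s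
    unfolding D_def using that finite by (intro Max_ge) auto
  obtain s where "s \<in> S" using nonempty by blast
  with D have "0 \<le> D" using zero_le_dist order_trans by blast
  define R where "R = D / (1 - r)"
  have R: "0 \<le> R" "r * R + D = R"
    using \<open>0 \<le> D\<close> ratio by (auto simp: R_def field_simps)
  have "dist (word_map F n w x) x \<le> R" if "range w \<subseteq> S" for n w
    using that
  proof (induction n arbitrary: w)
    case (Suc n)
    let ?y = "word_map F n (shift w) x"
    have "dist (F (w 0) ?y) x \<le> dist (F (w 0) ?y) (F (w 0) x) + dist (F (w 0) x) x"
      by (rule dist_triangle)
    also have "\<dots> \<le> r * dist ?y x + D"
      using contraction D range_word(1)[OF Suc.prems] by (intro add_mono) auto
    also have "\<dots> \<le> r * R + D"
      using Suc.IH range_word(2)[OF Suc.prems] ratio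
      by (intro add_right_mono mult_left_mono) auto
    finally show ?case using R by simp
  qed (use R in simp)
  then show thesis by (rule that)
qed

text \<open>The base point \<open>undefined\<close> is immaterial: by contraction all base points give the same limit.\<close>

definition coding :: "(nat \<Rightarrow> 's) \<Rightarrow> 'a" where
  "coding w = lim (\<lambda>n. word_map F n w undefined)"

lemma tendsto_coding:
  assumes w: "range w \<subseteq> S"
  shows "(\<lambda>n. word_map F n w x) \<longlonglongrightarrow> coding w"
proof -
  let ?b = "undefined :: 'a"
  obtain R where R: "\<And>n w. range w \<subseteq> S \<Longrightarrow> dist (word_map F n w ?b) ?b \<le> R"
    using orbits_bounded by blast
  have step: "dist (word_map F (n + m) w ?b) (word_map F n w ?b) \<le> r ^ n * R" for n m
  proof -
    have "dist (word_map F (n + m) w ?b) (word_map F n w ?b)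
        \<le> r ^ n * dist (word_map F m ((shift ^^ n) w) ?b) ?b"
      unfolding word_map_add using w by (rule word_map_contraction)
    also have "\<dots> \<le> r ^ n * R"
      using R[OF range_word(3)[OF w]] ratio by (intro mult_left_mono) auto
    finally show ?thesis .
  qed
  have "Cauchy (\<lambda>n. word_map F n w ?b)"
    unfolding Cauchy_altdef
  proof (intro allI impI)
    fix e :: real assume "0 < e"
    then obtain M where M: "\<And>n. n \<ge> M \<Longrightarrow> r ^ n * R < e"
      using order_tendstoD(2)[OF ratio_power_null] by (metis eventually_sequentially)
    have "dist (word_map F m w ?b) (word_map F n w ?b) < e" if "m \<ge> M" "n > m" for m n
      using step[of m "n - m"] M[OF that(1)] that(2) by (simp add: dist_commute)
    then show "\<exists>M. \<forall>m\<ge>M. \<forall>n>m. dist (word_map F m w ?b) (word_map F n w ?b) < e"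
      by blast
  qed
  then have lim: "(\<lambda>n. word_map F n w ?b) \<longlonglongrightarrow> coding w"
    unfolding coding_def by (simp add: Cauchy_convergent convergent_LIMSEQ_iff[symmetric])
  have "(\<lambda>n. dist (word_map F n w x) (coding w)) \<longlonglongrightarrow> 0"
  proof (rule tendsto_sandwich[OF _ _ tendsto_const])
    have "dist (word_map F n w x) (coding w)
        \<le> r ^ n * dist x ?b + dist (word_map F n w ?b) (coding w)" for n
      using dist_triangle[of "word_map F n w x" "coding w" "word_map F n w ?b"]
        word_map_contraction[OF w, of n x ?b] by linarith
    then show "\<forall>\<^sub>F n in sequentially. dist (word_map F n w x) (coding w)
        \<le> r ^ n * dist x ?b + dist (word_map F n w ?b) (coding w)"
      by simp
    show "(\<lambda>n. r ^ n * dist x ?b + dist (word_map F n w ?b) (coding w)) \<longlonglongrightarrow> 0"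
      using tendsto_add[OF ratio_power_null lim[unfolded tendsto_dist_iff[of _ "coding w"]]]
      by simp
  qed simp
  then show ?thesis unfolding tendsto_dist_iff[of _ "coding w"] .
qed

lemma coding_step:
  assumes w: "range w \<subseteq> S"
  shows "coding w = F (w 0) (coding (shift w))"
proof (rule LIMSEQ_unique)
  show "(\<lambda>n. word_map F (Suc n) w undefined) \<longlonglongrightarrow> coding w"
    using tendsto_coding[OF w] by (rule LIMSEQ_Suc)
  have "continuous_on UNIV (F (w 0))" using range_word(1)[OF w] by (rule continuous)
  moreover have "(\<lambda>n. word_map F n (shift w) undefined) \<longlonglongrightarrow> coding (shift w)"
    using range_word(2)[OF w] by (rule tendsto_coding)
  ultimately show "(\<lambda>n. word_map F (Suc n) w undefined) \<longlonglongrightarrow> F (w 0) (coding (shift w))"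
    by (auto intro: continuous_on_tendsto_compose)
qed

lemma coding_append_letter:
  assumes "s \<in> S" "range w \<subseteq> S"
  shows "coding (append_letter s w) = F s (coding w)"
  using coding_step[OF range_append_letter[OF assms]] by simp

lemma coding_prefix:
  assumes "range w \<subseteq> S"
  shows "coding w = word_map F n w (coding ((shift ^^ n) w))"
  using assms
proof (induction n arbitrary: w)
  case (Suc n)
  then show ?case
    using coding_step[OF Suc.prems] Suc.IH[OF range_word(2)[OF Suc.prems]]
    by (simp add: funpow_swap1)
qed simp

definition attractor :: "'a set" where
  "attractor = coding ` topspace (shift_space S)"

lemma mem_attractor_iff: "x \<in> attractor \<longleftrightarrow> (\<exists>w. range w \<subseteq> S \<and> x = coding w)"
  by (auto simp: attractor_def topspace_shift_space)

lemma attractor_nonempty: "attractor \<noteq> {}"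
proof -
  obtain s where "s \<in> S" using nonempty by blast
  then have "range (\<lambda>_. s) \<subseteq> S" by auto
  then have "coding (\<lambda>_. s) \<in> attractor" unfolding mem_attractor_iff by blast
  then show ?thesis by blast
qed

text \<open>Codes that agree in their last \<open>n\<close> letters lie in the image of a bounded set under the same
  \<open>n\<close>-fold composition, hence at distance \<open>O(r\<^sup>n)\<close>; these codes form an open set.\<close>

lemma continuous_map_coding: "continuous_map (shift_space S) euclidean coding"
  unfolding continuous_map_def
proof (intro conjI allI impI)
  fix U :: "'a set" assume U: "openin euclidean U"
  obtain R where R: "\<And>n w. range w \<subseteq> S \<Longrightarrow> dist (word_map F n w undefined) undefined \<le> R"
    using orbits_bounded by blast
  have bound: "dist (coding w) undefined \<le> R" if "range w \<subseteq> S" for w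
  proof (rule LIMSEQ_le_const2)
    show "(\<lambda>n. dist (word_map F n w undefined) undefined) \<longlonglongrightarrow> dist (coding w) undefined"
      using that by (intro tendsto_dist tendsto_coding tendsto_const)
  qed (use R that in blast)
  show "openin (shift_space S) {w \<in> topspace (shift_space S). coding w \<in> U}"
    (is "openin _ ?V")
  proof (subst openin_subopen, intro ballI)
    fix w assume "w \<in> ?V"
    then have w: "range w \<subseteq> S" and "coding w \<in> U" by (auto simp: topspace_shift_space)
    with U obtain e where e: "e > 0" "ball (coding w) e \<subseteq> U"
      by (metis open_openin open_contains_ball)
    then obtain n where n: "r ^ n * (2 * R) < e"
      using order_tendstoD(2)[OF ratio_power_null]
      by (metis (no_types, lifting) eventually_sequentially order_refl)
    define N where "N = PiE UNIV (\<lambda>j. if j < n then {w j} else S)"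
    have "{j. (if j < n then {w j} else S) \<noteq> S} \<subseteq> {..<n}" by (auto split: if_splits)
    then have "openin (shift_space S) N"
      unfolding N_def shift_space_def openin_PiE_gen
      using range_word(1)[OF w] by (auto intro: finite_subset)
    moreover have "w \<in> N" using w by (auto simp: N_def)
    moreover have "N \<subseteq> ?V"
    proof
      fix v assume "v \<in> N"
      then have vN: "v j \<in> (if j < n then {w j} else S)" for j
        unfolding N_def by (rule PiE_mem) simp
      have "v j \<in> S" for j using vN[of j] range_word(1)[OF w] by (auto split: if_splits)
      then have v: "range v \<subseteq> S" by blast
      have agree: "v j = w j" if "j < n" for j using vN[of j] that by simp
      let ?v = "coding ((shift ^^ n) v)" and ?w = "coding ((shift ^^ n) w)"
      have "dist (coding w) (coding v) = dist (word_map F n w ?w) (word_map F n w ?v)"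
        using coding_prefix[OF w, of n] coding_prefix[OF v, of n]
          word_map_cong[OF agree, where F = F] by simp
      also have "\<dots> \<le> r ^ n * dist ?w ?v" using w by (rule word_map_contraction)
      also have "\<dots> \<le> r ^ n * (2 * R)"
      proof (rule mult_left_mono)
        have "dist ?w ?v \<le> dist ?w undefined + dist ?v undefined" by (rule dist_triangle2)
        also have "\<dots> \<le> 2 * R"
          using bound[OF range_word(3)[OF w, of n]] bound[OF range_word(3)[OF v, of n]]
          by linarith
        finally show "dist ?w ?v \<le> 2 * R" .
      qed (use ratio in simp)
      finally show "v \<in> ?V" using n e v by (auto simp: topspace_shift_space)
    qed
    ultimately show "\<exists>T. openin (shift_space S) T \<and> w \<in> T \<and> T \<subseteq> ?V" by blast
  qed
qed simp

lemma compact_attractor: "compact attractor"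
proof -
  have "compact_space (shift_space S)"
    by (simp add: shift_space_def compact_space_product_topology compact_space_discrete_topology
        finite)
  then show ?thesis
    unfolding attractor_def
    using image_compactin[OF _ continuous_map_coding] compact_space_def by fastforce
qed

lemma attractor_invariant: "attractor = (\<Union>s\<in>S. F s ` attractor)"
proof (intro equalityI subsetI)
  fix x assume "x \<in> attractor"
  then obtain w where w: "range w \<subseteq> S" "x = coding w" unfolding mem_attractor_iff by blast
  have "coding (shift w) \<in> attractor"
    using range_word(2)[OF w(1)] unfolding mem_attractor_iff by blast
  with w(2) coding_step[OF w(1)] range_word(1)[OF w(1)]
  show "x \<in> (\<Union>s\<in>S. F s ` attractor)" by blast
next
  fix x assume "x \<in> (\<Union>s\<in>S. F s ` attractor)"
  then obtain s w where s: "s \<in> S" and w: "range w \<subseteq> S" and x: "x = F s (coding w)"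
    by (auto simp: mem_attractor_iff)
  show "x \<in> attractor"
    unfolding mem_attractor_iff
    using coding_append_letter[OF s w] range_append_letter[OF s w] x by metis
qed

lemma coding_map_coding: "coding_map attractor S F coding"
  by (auto simp: coding_map_def continuous_map_in_subtopology continuous_map_coding attractor_def
      coding_append_letter topspace_shift_space)

text \<open>Starting the defining limits of the coding map at a point of \<open>B\<close> keeps them in \<open>B\<close>.\<close>

lemma attractor_subset_closed:
  assumes "closed B" "B \<noteq> {}" and inv: "\<And>s. s \<in> S \<Longrightarrow> F s ` B \<subseteq> B"
  shows "attractor \<subseteq> B"
proof
  fix x assume "x \<in> attractor"
  then obtain w where w: "range w \<subseteq> S" "x = coding w" unfolding mem_attractor_iff by blast
  obtain b where "b \<in> B" using assms by blast
  have "word_map F n v b \<in> B" if "range v \<subseteq> S" for n v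
    using that
  proof (induction n arbitrary: v)
    case (Suc n)
    then show ?case using range_word[OF Suc.prems] inv by (simp add: image_subset_iff)
  qed (use \<open>b \<in> B\<close> in simp)
  with w show "x \<in> B"
    using closed_sequentially[OF \<open>closed B\<close> _ tendsto_coding[OF w(1), of b]] by blast
qed

text \<open>In a set covered by its own images every point has a preimage in the set under one of the
  maps; choosing preimages again and again spells out a code of the point.\<close>

lemma bounded_subset_attractor:
  assumes "bounded B" and cover: "B \<subseteq> (\<Union>s\<in>S. F s ` B)"
  shows "B \<subseteq> attractor"
proof
  fix x assume "x \<in> B"
  have "\<forall>z\<in>B. \<exists>s y. s \<in> S \<and> y \<in> B \<and> z = F s y" using cover by blast
  then obtain s y where sy: "\<And>z. z \<in> B \<Longrightarrow> s z \<in> S \<and> y z \<in> B \<and> z = F (s z) (y z)"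
    by metis
  define w where "w = (\<lambda>n. s ((y ^^ n) x))"
  have yB: "(y ^^ n) x \<in> B" for n using \<open>x \<in> B\<close> sy by (induction n) auto
  then have w: "range w \<subseteq> S" using sy by (auto simp: w_def)
  have pre: "word_map F n w ((y ^^ n) x) = x" for n
  proof (induction n)
    case (Suc n)
    have "F (w n) ((y ^^ Suc n) x) = (y ^^ n) x" using sy[OF yB[of n]] by (simp add: w_def)
    with Suc show ?case unfolding word_map_Suc_right by simp
  qed simp
  obtain e where e: "\<And>z. z \<in> B \<Longrightarrow> dist x z \<le> e"
    using \<open>bounded B\<close> bounded_any_center by metis
  have bound: "dist (word_map F n w x) x \<le> r ^ n * e" for n
  proof -
    have "dist (word_map F n w x) x \<le> r ^ n * dist x ((y ^^ n) x)"
      using word_map_contraction[OF w, of n x "(y ^^ n) x"] by (simp add: pre)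
    also have "\<dots> \<le> r ^ n * e" using e yB ratio by (intro mult_left_mono) auto
    finally show ?thesis .
  qed
  have "(\<lambda>n. dist (word_map F n w x) x) \<longlonglongrightarrow> 0"
    by (rule tendsto_sandwich[OF _ _ tendsto_const ratio_power_null[of e]])
       (simp_all add: bound)
  then have "(\<lambda>n. word_map F n w x) \<longlonglongrightarrow> x" unfolding tendsto_dist_iff[of _ x] .
  then have "x = coding w" using tendsto_coding[OF w] by (rule LIMSEQ_unique)
  with w show "x \<in> attractor" unfolding mem_attractor_iff by blast
qed

lemma attractor_characterization:
  "K \<noteq> {} \<and> compact K \<and> K = (\<Union>s\<in>S. F s ` K) \<longleftrightarrow> K = attractor"
proof
  assume K: "K \<noteq> {} \<and> compact K \<and> K = (\<Union>s\<in>S. F s ` K)"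
  show "K = attractor"
  proof
    show "K \<subseteq> attractor" using K by (intro bounded_subset_attractor compact_imp_bounded) auto
    show "attractor \<subseteq> K" using K by (intro attractor_subset_closed compact_imp_closed) blast+
  qed
next
  assume "K = attractor"
  then show "K \<noteq> {} \<and> compact K \<and> K = (\<Union>s\<in>S. F s ` K)"
    using attractor_nonempty compact_attractor attractor_invariant by blast
qed

lemma self_similar_structure_attractor:
  assumes "\<And>s. s \<in> S \<Longrightarrow> inj_on (F s) attractor"
  shows "self_similar_structure attractor S F"
proof -
  have "F s ` attractor \<subseteq> attractor" if "s \<in> S" for s using attractor_invariant that by blast
  then show ?thesis
    unfolding self_similar_structure_def
    using assms compact_attractor finite continuous coding_map_coding by blast
qed

end

section \<open>Barycentric coordinates\<close>

locale affine_frame =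
  fixes k :: nat and p :: "nat \<Rightarrow> 'a::euclidean_space"
  assumes inj: "inj_on p {..<k}" and indep: "\<not> affine_dependent (p ` {..<k})"
    and span: "affine hull (p ` {..<k}) = UNIV"
begin

definition bary :: "'a \<Rightarrow> nat \<Rightarrow> real" where
  "bary x = (SOME u. (\<Sum>i<k. u i) = 1 \<and> (\<Sum>i<k. u i *\<^sub>R p i) = x)"

lemma bary: "(\<Sum>i<k. bary x i) = 1" "(\<Sum>i<k. bary x i *\<^sub>R p i) = x"
proof -
  obtain u where "sum u (p ` {..<k}) = 1" "(\<Sum>v\<in>p ` {..<k}. u v *\<^sub>R v) = x"
    using span affine_hull_finite[of "p ` {..<k}"] by blast
  then have "(\<Sum>i<k. u (p i)) = 1 \<and> (\<Sum>i<k. u (p i) *\<^sub>R p i) = x"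
    using inj by (simp add: sum.reindex)
  then have "(\<Sum>i<k. bary x i) = 1 \<and> (\<Sum>i<k. bary x i *\<^sub>R p i) = x"
    unfolding bary_def by (rule someI[where P = "\<lambda>u. (\<Sum>i<k. u i) = 1 \<and> (\<Sum>i<k. u i *\<^sub>R p i) = x"])
  then show "(\<Sum>i<k. bary x i) = 1" "(\<Sum>i<k. bary x i *\<^sub>R p i) = x" by auto
qed

lemma bary_unique:
  assumes "(\<Sum>i<k. u i) = 1" "(\<Sum>i<k. u i *\<^sub>R p i) = x" "i < k"
  shows "bary x i = u i"
proof (rule ccontr)
  assume ne: "bary x i \<noteq> u i"
  define U where "U v = (let j = inv_into {..<k} p v in bary x j - u j)" for v
  have U: "U (p j) = bary x j - u j" if "j < k" for j
    using that inj by (simp add: U_def Let_def)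
  have "sum U (p ` {..<k}) = 0"
    using inj assms bary(1)[of x] by (simp add: sum.reindex U sum_subtractf)
  moreover have "(\<Sum>v\<in>p ` {..<k}. U v *\<^sub>R v) = 0"
    using inj assms bary(2)[of x] by (simp add: sum.reindex U sum_subtractf scaleR_diff_left)
  moreover have "\<exists>v\<in>p ` {..<k}. U v \<noteq> 0" using ne U assms(3) by auto
  ultimately show False
    using indep affine_dependent_explicit_finite[of "p ` {..<k}"] by blast
qed

lemma bary_inject:
  assumes "\<And>i. i < k \<Longrightarrow> bary x i = bary y i"
  shows "x = y"
proof -
  have "(\<Sum>i<k. bary x i *\<^sub>R p i) = (\<Sum>i<k. bary y i *\<^sub>R p i)"
    using assms by (intro sum.cong) auto
  then show ?thesis by (simp add: bary(2))
qed

lemma bary_vertex: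
  assumes "j < k" "i < k"
  shows "bary (p j) i = (if i = j then 1 else 0)"
proof (rule bary_unique)
  have "(\<Sum>i<k. (if i = j then 1 else 0) *\<^sub>R p i) = (\<Sum>i<k. if i = j then p i else 0)"
    by (intro sum.cong) auto
  then show "(\<Sum>i<k. (if i = j then 1 else 0) *\<^sub>R p i) = p j" using assms by simp
qed (use assms in auto)

lemma bary_add: "i < k \<Longrightarrow> bary (x + y) i = bary x i + bary y i - bary 0 i"
  by (rule bary_unique)
     (simp_all add: sum.distrib sum_subtractf scaleR_diff_left scaleR_add_left bary)

lemma bary_scaleR:
  assumes "i < k"
  shows "bary (a *\<^sub>R x) i = a * bary x i + (1 - a) * bary 0 i"
proof (rule bary_unique[OF _ _ assms])
  show "(\<Sum>i<k. a * bary x i + (1 - a) * bary 0 i) = 1"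
    by (simp add: sum.distrib bary(1) sum_distrib_left[symmetric])
  have "(\<Sum>i<k. (a * bary x i + (1 - a) * bary 0 i) *\<^sub>R p i)
      = (\<Sum>i<k. a *\<^sub>R (bary x i *\<^sub>R p i) + (1 - a) *\<^sub>R (bary 0 i *\<^sub>R p i))"
    by (simp add: scaleR_add_left)
  also have "\<dots> = a *\<^sub>R x"
    by (simp only: sum.distrib scaleR_sum_right[symmetric] bary(2)) simp
  finally show "(\<Sum>i<k. (a * bary x i + (1 - a) * bary 0 i) *\<^sub>R p i) = a *\<^sub>R x" .
qed

lemma affine_map_combination:
  assumes "affine_map f" "(\<Sum>i<k. u i) = 1"
  shows "f (\<Sum>i<k. u i *\<^sub>R p i) = (\<Sum>i<k. u i *\<^sub>R f (p i))"
proof -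
  obtain L b where L: "linear L" and f: "f = (\<lambda>x. L x + b)"
    using assms(1) by (auto simp: affine_map_def)
  have "(\<Sum>i<k. u i *\<^sub>R b) = b" using assms(2) by (simp flip: scaleR_left.sum)
  then show ?thesis
    by (simp add: f linear_sum[OF L] linear_cmul[OF L] scaleR_add_right sum.distrib)
qed

text \<open>This evaluates the definite description in \<open>simplex_map\<close>; with Kronecker deltas as prescribed
  values it also shows that the coordinate functions are affine, hence continuous.\<close>

lemma affine_map_interpolation:
  fixes g :: "nat \<Rightarrow> 'b::real_vector"
  shows "affine_map f \<and> (\<forall>j<k. f (p j) = g j) \<longleftrightarrow> f = (\<lambda>x. \<Sum>j<k. bary x j *\<^sub>R g j)"
    (is "_ \<longleftrightarrow> f = ?G")
proof
  assume f: "affine_map f \<and> (\<forall>j<k. f (p j) = g j)"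
  show "f = ?G"
  proof
    fix x
    have "f x = f (\<Sum>j<k. bary x j *\<^sub>R p j)" by (simp add: bary)
    also have "\<dots> = (\<Sum>j<k. bary x j *\<^sub>R f (p j))"
      using f by (intro affine_map_combination) (auto simp: bary)
    also have "\<dots> = ?G x" using f by (intro sum.cong) auto
    finally show "f x = ?G x" .
  qed
next
  assume f: "f = ?G"
  have "linear (\<lambda>x. ?G x - ?G 0)"
  proof (rule linearI)
    fix x y :: 'a and a :: real
    have "?G (x + y) = (\<Sum>j<k. (bary x j + bary y j - bary 0 j) *\<^sub>R g j)"
      by (intro sum.cong) (auto simp: bary_add)
    then show "?G (x + y) - ?G 0 = (?G x - ?G 0) + (?G y - ?G 0)"
      by (simp add: scaleR_add_left scaleR_diff_left sum.distrib sum_subtractf)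
    have "?G (a *\<^sub>R x) = (\<Sum>j<k. (a * bary x j + (1 - a) * bary 0 j) *\<^sub>R g j)"
      by (intro sum.cong) (auto simp: bary_scaleR)
    also have "\<dots> = a *\<^sub>R ?G x + (1 - a) *\<^sub>R ?G 0"
      by (simp add: scaleR_add_left sum.distrib scaleR_sum_right)
    finally show "?G (a *\<^sub>R x) - ?G 0 = a *\<^sub>R (?G x - ?G 0)"
      by (simp add: scaleR_diff_right scaleR_diff_left)
  qed
  then have "affine_map f"
    unfolding affine_map_def f by (intro exI[of _ "\<lambda>x. ?G x - ?G 0"] exI[of _ "?G 0"]) auto
  moreover have "f (p j) = g j" if "j < k" for j
  proof -
    have "f (p j) = (\<Sum>i<k. if i = j then g i else 0)"
      unfolding f using that by (intro sum.cong) (auto simp: bary_vertex)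
    then show ?thesis using that by simp
  qed
  ultimately show "affine_map f \<and> (\<forall>j<k. f (p j) = g j)" by blast
qed

lemma continuous_on_bary:
  assumes "i < k"
  shows "continuous_on A (\<lambda>x. bary x i)"
proof -
  have "(\<lambda>x. bary x i) = (\<lambda>x. \<Sum>j<k. bary x j *\<^sub>R (if j = i then 1 else 0))"
    using assms by (simp add: if_distrib cong: if_cong)
  then have "affine_map (\<lambda>x. bary x i)" by (rule affine_map_interpolation[THEN iffD2, THEN conjunct1])
  then obtain L b where "linear L" "(\<lambda>x. bary x i) = (\<lambda>x. L x + b)"
    by (auto simp: affine_map_def)
  then show ?thesis
    by (simp only:) (intro continuous_intros linear_continuous_on,
        simp add: linear_conv_bounded_linear)
qed

section \<open>The simplex maps in coordinates\<close>

text \<open>The action of the \<open>i\<close>-th simplex map on barycentric coordinates.\<close>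

definition image_coord :: "nat \<Rightarrow> (nat \<Rightarrow> real) \<Rightarrow> nat \<Rightarrow> real" where
  "image_coord i u l =
     (if l = i then u i + (1 - u i) / (real k - 1) else (1 - u i - u l) / (real k - 1))"

lemma simplex_map_eq:
  assumes "i < k"
  shows "simplex_map k p i x =
    (\<Sum>j<k. bary x j *\<^sub>R (if j = i then p i else facet_barycenter k p j))"
proof -
  have "(affine_map f \<and> f (p i) = p i \<and> (\<forall>j<k. j \<noteq> i \<longrightarrow> f (p j) = facet_barycenter k p j))
      \<longleftrightarrow> f = (\<lambda>x. \<Sum>j<k. bary x j *\<^sub>R (if j = i then p i else facet_barycenter k p j))" for f
    unfolding affine_map_interpolation[symmetric] using assms by auto
  then show ?thesis
    unfolding simplex_map_def by simp
qed

lemma bary_simplex_map_ge_2: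
  assumes i: "i < k" and l: "l < k" and k: "k \<ge> 2"
  shows "bary (simplex_map k p i x) l = image_coord i (bary x) l"
proof (rule bary_unique[OF _ _ l])
  let ?u = "bary x" and ?n = "real k - 1" and ?J = "{..<k} - {i}"
  let ?c = "?u i + ?u i / ?n"
  have n: "?n > 0" using k by simp
  \<comment> \<open>Separating the excess \<open>?c\<close> at \<open>i\<close> leaves an expression that is uniform in \<open>l\<close> and can be summed.\<close>
  have coord: "image_coord i ?u l = (1 - ?u i - ?u l) / ?n + (if l = i then ?c else 0)" for l
    by (simp add: image_coord_def field_simps diff_divide_distrib)
  have "(\<Sum>l<k. image_coord i ?u l) = ((?n + 1) * (1 - ?u i) - 1) / ?n + ?c"
    unfolding coord using i bary(1)[of x]
    by (simp add: sum.distrib sum_subtractf flip: sum_divide_distrib)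
  also have "\<dots> = 1"
  proof -
    have "((m + 1) * (1 - a) - 1) / m + (a + a / m) = 1" if "m > 0" for m a :: real
      using that by (simp add: field_simps)
    then show ?thesis using n by blast
  qed
  finally show "(\<Sum>l<k. image_coord i ?u l) = 1" .
  define P where "P = (\<Sum>l<k. p l)"
  have q: "facet_barycenter k p j = (1 / ?n) *\<^sub>R (P - p j)" if "j < k" for j
    using that by (simp add: facet_barycenter_def P_def sum_diff1)
  have "(\<Sum>l<k. image_coord i ?u l *\<^sub>R p l)
      = (\<Sum>l<k. ((1 - ?u i) / ?n) *\<^sub>R p l - (1 / ?n) *\<^sub>R (?u l *\<^sub>R p l)
          + (if l = i then ?c *\<^sub>R p i else 0))"
    unfolding coord by (intro sum.cong) (auto simp: scaleR_add_left scaleR_diff_left diff_divide_distrib)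
  also have "\<dots> = ((1 - ?u i) / ?n) *\<^sub>R P - (1 / ?n) *\<^sub>R x + ?c *\<^sub>R p i"
    using i by (simp only: sum.distrib sum_subtractf P_def bary(2) scaleR_sum_right[symmetric])
      simp
  also have "\<dots> = ?u i *\<^sub>R p i + (1 / ?n) *\<^sub>R ((1 - ?u i) *\<^sub>R P - (x - ?u i *\<^sub>R p i))"
    by (simp add: scaleR_add_left scaleR_diff_right)
  also have "(1 - ?u i) *\<^sub>R P - (x - ?u i *\<^sub>R p i) = (\<Sum>j\<in>?J. ?u j *\<^sub>R (P - p j))"
  proof -
    have "(\<Sum>j\<in>?J. ?u j) = 1 - ?u i" using i bary(1)[of x] by (simp add: sum_diff1)
    moreover have "(\<Sum>j\<in>?J. ?u j *\<^sub>R p j) = x - ?u i *\<^sub>R p i"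
      using i bary(2)[of x] by (simp add: sum_diff1)
    ultimately show ?thesis
      by (simp add: scaleR_diff_right sum_subtractf flip: scaleR_left.sum)
  qed
  also have "?u i *\<^sub>R p i + (1 / ?n) *\<^sub>R (\<Sum>j\<in>?J. ?u j *\<^sub>R (P - p j))
      = ?u i *\<^sub>R p i + (\<Sum>j\<in>?J. ?u j *\<^sub>R (if j = i then p i else facet_barycenter k p j))"
    by (auto simp: scaleR_sum_right q intro!: sum.cong)
  also have "\<dots> = simplex_map k p i x"
    using i by (simp add: simplex_map_eq sum.remove[of "{..<k}" i])
  finally show "(\<Sum>l<k. image_coord i ?u l *\<^sub>R p l) = simplex_map k p i x" .
qed

end

section \<open>Regular simplices\<close>

text \<open>Expand the square and replace \<open>2 * (p i \<bullet> p j)\<close> by the squared norms and the squared distance.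
  The terms with the norms vanish since the coefficients sum to zero, and for the same reason
  subtracting \<open>d\<^sup>2\<close> off the diagonal amounts to adding it on the diagonal.\<close>

lemma norm_sq_combination_equidistant:
  fixes p :: "nat \<Rightarrow> 'a::real_inner"
  assumes dist: "\<And>i j. i < k \<Longrightarrow> j < k \<Longrightarrow> i \<noteq> j \<Longrightarrow> dist (p i) (p j) = d"
    and v: "(\<Sum>i<k. v i) = 0"
  shows "(norm (\<Sum>i<k. v i *\<^sub>R p i))\<^sup>2 = d\<^sup>2 / 2 * (\<Sum>i<k. (v i)\<^sup>2)"
proof -
  have inner: "2 * (p i \<bullet> p j) = (norm (p i))\<^sup>2 + (norm (p j))\<^sup>2 - (if i = j then 0 else d\<^sup>2)"
    if "i < k" "j < k" for i j
  proof (cases "i = j")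
    case False
    then have "d\<^sup>2 = (norm (p i - p j))\<^sup>2" using dist that by (simp add: dist_norm)
    then show ?thesis using False
      by (simp add: power2_norm_eq_inner inner_diff_left inner_diff_right inner_commute)
  qed (simp add: power2_norm_eq_inner)
  have "2 * (norm (\<Sum>i<k. v i *\<^sub>R p i))\<^sup>2 = (\<Sum>i<k. \<Sum>j<k. v i * v j * (2 * (p i \<bullet> p j)))"
    by (simp add: power2_norm_eq_inner inner_sum_left inner_sum_right sum_distrib_left mult_ac inner_commute)
  also have "\<dots> = (\<Sum>i<k. \<Sum>j<k. (v i * (norm (p i))\<^sup>2) * v j + v i * (v j * (norm (p j))\<^sup>2)
      - d\<^sup>2 * (v i * v j) + (if i = j then d\<^sup>2 * (v i)\<^sup>2 else 0))"
    by (intro sum.cong refl)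
       (auto simp: inner algebra_simps power2_eq_square)
  also have "\<dots> = (\<Sum>i<k. v i * (norm (p i))\<^sup>2) * (\<Sum>j<k. v j)
      + (\<Sum>i<k. v i) * (\<Sum>j<k. v j * (norm (p j))\<^sup>2)
      - d\<^sup>2 * ((\<Sum>i<k. v i) * (\<Sum>j<k. v j)) + (\<Sum>i<k. d\<^sup>2 * (v i)\<^sup>2)"
    by (simp only: sum_product) (simp add: sum.distrib sum_subtractf sum_distrib_left)
  also have "\<dots> = d\<^sup>2 * (\<Sum>i<k. (v i)\<^sup>2)" using v by (simp add: sum_distrib_left)
  finally show ?thesis by simp
qed

locale regular_simplex = affine_frame k p for k and p :: "nat \<Rightarrow> 'a::euclidean_space" +
  fixes d :: real
  assumes k: "k \<ge> 3"
    and dist: "i < k \<Longrightarrow> j < k \<Longrightarrow> i \<noteq> j \<Longrightarrow> dist (p i) (p j) = d"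
begin

lemma bary_simplex_map:
  "i < k \<Longrightarrow> l < k \<Longrightarrow> bary (simplex_map k p i x) l = image_coord i (bary x) l"
  using k by (intro bary_simplex_map_ge_2) auto

lemma dist_sq_bary: "(dist x y)\<^sup>2 = d\<^sup>2 / 2 * (\<Sum>l<k. (bary x l - bary y l)\<^sup>2)"
proof -
  have "(\<Sum>l<k. (bary x l - bary y l) *\<^sub>R p l) = x - y"
    by (simp add: scaleR_diff_left sum_subtractf bary(2))
  moreover have "(\<Sum>l<k. bary x l - bary y l) = 0" by (simp add: sum_subtractf bary(1))
  ultimately show ?thesis
    using norm_sq_combination_equidistant[of k p d "\<lambda>l. bary x l - bary y l"] dist
    by (simp add: dist_norm)
qed

text \<open>Let \<open>n = k - 1\<close> and let \<open>v\<close> be the difference of the coordinates of two points. The differences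
  of the coordinates of their images under the \<open>i\<close>-th map have square sum
  \<open>(n\<^sup>2 - n - 1) / n\<^sup>2 * (v i)\<^sup>2 + 1 / n\<^sup>2 * (\<Sum>l\<noteq>i. (v l)\<^sup>2)\<close>, and \<open>1 \<le> n\<^sup>2 - n - 1\<close> since \<open>n \<ge> 2\<close>.\<close>

definition ratio :: real where
  "ratio = sqrt (((real k - 1)\<^sup>2 - (real k - 1) - 1) / (real k - 1)\<^sup>2)"

lemma ratio: "0 \<le> ratio" "ratio < 1" "ratio\<^sup>2 = ((real k - 1)\<^sup>2 - (real k - 1) - 1) / (real k - 1)\<^sup>2"
proof -
  define n where "n = real k - 1"
  have n: "n \<ge> 2" using k by (simp add: n_def)
  have "n * 2 \<le> n * n" using n by (intro mult_left_mono) auto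
  then have "0 \<le> n\<^sup>2 - n - 1" using n unfolding power2_eq_square by linarith
  then have "0 \<le> (n\<^sup>2 - n - 1) / n\<^sup>2" "(n\<^sup>2 - n - 1) / n\<^sup>2 < 1"
    using n by auto
  then show "0 \<le> ratio" "ratio < 1"
    "ratio\<^sup>2 = ((real k - 1)\<^sup>2 - (real k - 1) - 1) / (real k - 1)\<^sup>2"
    by (auto simp: ratio_def n_def)
qed

lemma dist_simplex_map_le:
  assumes i: "i < k"
  shows "dist (simplex_map k p i x) (simplex_map k p i y) \<le> ratio * dist x y"
proof (rule power2_le_imp_le)
  define n where "n = real k - 1"
  have n: "n \<ge> 2" using k by (simp add: n_def)
  let ?v = "\<lambda>l. bary x l - bary y l" and ?J = "{..<k} - {i}"
  let ?w = "\<lambda>l. bary (simplex_map k p i x) l - bary (simplex_map k p i y) l"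
  define A where "A = (\<Sum>l\<in>?J. (?v l)\<^sup>2)"
  have "A \<ge> 0" by (simp add: A_def sum_nonneg)
  have card: "real (card ?J) = n" using i k by (simp add: n_def)
  have v: "(\<Sum>l<k. (?v l)\<^sup>2) = (?v i)\<^sup>2 + A" using i by (simp add: A_def sum.remove)
  have sumJ: "(\<Sum>l\<in>?J. ?v l) = - ?v i"
    using i bary(1)[of x] bary(1)[of y] by (simp add: sum_diff1 sum_subtractf)
  have "(\<Sum>l<k. (?w l)\<^sup>2) = (?w i)\<^sup>2 + (\<Sum>l\<in>?J. (?w l)\<^sup>2)"
    using i by (simp add: sum.remove)
  also have "?w i = ?v i * (n - 1) / n"
    using i n by (simp add: bary_simplex_map image_coord_def n_def[symmetric] field_simps)
  \<comment> \<open>The mixed terms sum to a multiple of \<open>(?v i)\<^sup>2\<close> because \<open>?v\<close> sums to zero.\<close>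
  also have "(\<Sum>l\<in>?J. (?w l)\<^sup>2) = (\<Sum>l\<in>?J. ((?v i)\<^sup>2 + 2 * ?v i * ?v l + (?v l)\<^sup>2) / n\<^sup>2)"
  proof (intro sum.cong refl)
    fix l assume "l \<in> ?J"
    then have "?w l = - (?v i + ?v l) / n"
      using i n by (simp add: bary_simplex_map image_coord_def n_def[symmetric] field_simps)
    then show "(?w l)\<^sup>2 = ((?v i)\<^sup>2 + 2 * ?v i * ?v l + (?v l)\<^sup>2) / n\<^sup>2"
      by (simp only: power_divide power2_minus power2_sum) (simp add: add_ac)
  qed
  also have "\<dots> = (n * (?v i)\<^sup>2 + 2 * ?v i * (\<Sum>l\<in>?J. ?v l) + A) / n\<^sup>2"
    by (simp only: sum_divide_distrib[symmetric] sum.distrib sum_distrib_left[symmetric]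
        sum_constant card A_def)
  also have "\<dots> = ((n - 2) * (?v i)\<^sup>2 + A) / n\<^sup>2"
    unfolding sumJ by (simp add: algebra_simps power2_eq_square)
  also have "(?v i * (n - 1) / n)\<^sup>2 + ((n - 2) * (?v i)\<^sup>2 + A) / n\<^sup>2
      = ((n\<^sup>2 - n - 1) * (?v i)\<^sup>2 + A) / n\<^sup>2"
    by (simp add: power_divide power_mult_distrib add_divide_distrib[symmetric])
       (simp add: algebra_simps power2_eq_square)
  also have "\<dots> \<le> ((n\<^sup>2 - n - 1) * (?v i)\<^sup>2 + (n\<^sup>2 - n - 1) * A) / n\<^sup>2"
  proof -
    have "n * 2 \<le> n * n" using n by (intro mult_left_mono) auto
    then have "1 \<le> n\<^sup>2 - n - 1" using n unfolding power2_eq_square by linarith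
    then have "1 * A \<le> (n\<^sup>2 - n - 1) * A" using \<open>A \<ge> 0\<close> by (rule mult_right_mono)
    then show ?thesis by (intro divide_right_mono) auto
  qed
  also have "\<dots> = ratio\<^sup>2 * (\<Sum>l<k. (?v l)\<^sup>2)"
    unfolding v ratio(3) n_def[symmetric] by (simp add: distrib_left add_divide_distrib)
  finally have "d\<^sup>2 / 2 * (\<Sum>l<k. (?w l)\<^sup>2) \<le> d\<^sup>2 / 2 * (ratio\<^sup>2 * (\<Sum>l<k. (?v l)\<^sup>2))"
    by (intro mult_left_mono) auto
  then show "(dist (simplex_map k p i x) (simplex_map k p i y))\<^sup>2 \<le> (ratio * dist x y)\<^sup>2"
    unfolding power_mult_distrib dist_sq_bary by (simp only: mult.left_commute)
qed (simp add: ratio)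

sublocale ifs: contracting_ifs "{..<k}" "simplex_map k p" ratio
  using k ratio dist_simplex_map_le by unfold_locales (auto simp: lessThan_empty_iff)

lemma simplex_attractor_eq: "simplex_attractor k p = ifs.attractor"
  unfolding simplex_attractor_def ifs.attractor_characterization by simp

text \<open>The coordinate at \<open>i\<close> of the image determines \<open>bary x i\<close>, as it depends on it with slope
  \<open>(k - 2) / (k - 1) \<noteq> 0\<close>; the other coordinates then follow.\<close>

lemma inj_simplex_map:
  assumes i: "i < k"
  shows "inj (simplex_map k p i)"
proof (rule injI)
  fix x y assume eq: "simplex_map k p i x = simplex_map k p i y"
  define n where "n = real k - 1"
  have n: "n \<ge> 2" using k by (simp add: n_def)
  have coords: "image_coord i (bary x) l = image_coord i (bary y) l" if "l < k" for l
    using bary_simplex_map[OF i that] eq by metis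
  have "(n - 1) * bary x i = (n - 1) * bary y i"
    using coords[OF i] n by (simp add: image_coord_def n_def[symmetric] field_simps)
  then have eq_i: "bary x i = bary y i" using n by simp
  show "x = y"
  proof (rule bary_inject)
    fix l assume "l < k"
    then show "bary x l = bary y l"
      using coords[of l] eq_i n by (cases "l = i") (auto simp: image_coord_def n_def[symmetric])
  qed
qed

section \<open>Where the pieces of the attractor meet\<close>

definition solid_simplex :: "'a set" where
  "solid_simplex = {x. \<forall>l<k. 0 \<le> bary x l}"

lemma bary_sum_le_1:
  assumes "x \<in> solid_simplex" "J \<subseteq> {..<k}"
  shows "(\<Sum>l\<in>J. bary x l) \<le> 1"
proof -
  have "(\<Sum>l\<in>J. bary x l) \<le> (\<Sum>l<k. bary x l)"
    using assms by (intro sum_mono2) (auto simp: solid_simplex_def)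
  then show ?thesis by (simp add: bary(1))
qed

lemma simplex_map_solid_simplex:
  assumes i: "i < k"
  shows "simplex_map k p i ` solid_simplex \<subseteq> solid_simplex"
proof (clarsimp simp: solid_simplex_def)
  fix x l assume x: "\<forall>l<k. 0 \<le> bary x l" and l: "l < k"
  then have xs: "x \<in> solid_simplex" by (simp add: solid_simplex_def)
  have "bary x i \<le> 1" using bary_sum_le_1[OF xs, of "{i}"] i by simp
  moreover have "bary x i + bary x l \<le> 1" if "l \<noteq> i"
    using bary_sum_le_1[OF xs, of "{i, l}"] i l that by simp
  ultimately show "0 \<le> bary (simplex_map k p i x) l"
    using x i l k by (auto simp: bary_simplex_map image_coord_def)
qed

lemma attractor_subset_solid_simplex: "ifs.attractor \<subseteq> solid_simplex"
proof (rule ifs.attractor_subset_closed)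
  have "solid_simplex = (\<Inter>l\<in>{..<k}. {x. 0 \<le> bary x l})" by (auto simp: solid_simplex_def)
  moreover have "closed {x. 0 \<le> bary x l}" if "l < k" for l
    using that by (intro closed_Collect_le continuous_on_bary) auto
  ultimately show "closed solid_simplex" by auto
  have "p 0 \<in> solid_simplex" using k by (simp add: solid_simplex_def bary_vertex)
  then show "solid_simplex \<noteq> {}" by blast
qed (use simplex_map_solid_simplex in auto)

lemma simplex_map_vertex: "l < k \<Longrightarrow> simplex_map k p l (p l) = p l"
  using k by (intro bary_inject) (auto simp: bary_simplex_map bary_vertex image_coord_def)

lemma vertex_if_bary_eq_1:
  assumes "x \<in> solid_simplex" "l < k" "bary x l = 1"
  shows "x = p l"
proof (rule bary_inject)
  fix j assume j: "j < k"
  show "bary x j = bary (p l) j"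
  proof (cases "j = l")
    case False
    then have "bary x l + bary x j \<le> 1"
      using bary_sum_le_1[OF assms(1), of "{l, j}"] j assms(2) by simp
    moreover have "0 \<le> bary x j" using assms(1) j by (simp add: solid_simplex_def)
    ultimately show ?thesis using assms False j by (simp add: bary_vertex)
  qed (use assms in \<open>simp add: bary_vertex\<close>)
qed

lemma bary_simplex_map_pos:
  assumes "x \<in> solid_simplex" "i < k"
  shows "0 < bary (simplex_map k p i x) i"
proof -
  define n where "n = real k - 1"
  have n: "n \<ge> 2" using k by (simp add: n_def)
  have "0 \<le> bary x i" using assms by (simp add: solid_simplex_def)
  then have "0 < (n - 1) * bary x i + 1" using n by (intro add_nonneg_pos mult_nonneg_nonneg) auto
  then show ?thesis
    using assms n by (simp add: bary_simplex_map image_coord_def n_def[symmetric] field_simps)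
qed

text \<open>Comparing the coordinates at \<open>i\<close> gives \<open>(k - 2) x\<^sub>i + y\<^sub>i + y\<^sub>j = 0\<close>, a vanishing sum of
  nonnegative terms. The coordinates at \<open>j\<close> then give \<open>x\<^sub>j = 0\<close>.\<close>

lemma overlap_bary_eq_0:
  assumes x: "x \<in> solid_simplex" and y: "y \<in> solid_simplex" and ij: "i < k" "j < k" "i \<noteq> j"
    and eq: "simplex_map k p i x = simplex_map k p j y"
  shows "bary x i = 0" "bary x j = 0"
proof -
  define n where "n = real k - 1"
  have n: "n \<ge> 2" using k by (simp add: n_def)
  have nonneg: "0 \<le> bary x i" "0 \<le> bary x j" "0 \<le> bary y i" "0 \<le> bary y j"
    using x y ij by (auto simp: solid_simplex_def)
  have coords: "image_coord i (bary x) l = image_coord j (bary y) l" if "l < k" for l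
    using bary_simplex_map[OF ij(1) that] bary_simplex_map[OF ij(2) that] eq by metis
  have "(n - 1) * bary x i + bary y i + bary y j = 0"
    using coords[OF ij(1)] ij n by (simp add: image_coord_def n_def[symmetric] field_simps)
  moreover have "0 \<le> (n - 1) * bary x i" using n nonneg by simp
  ultimately have zero: "(n - 1) * bary x i = 0" "bary y j = 0" using nonneg by linarith+
  then show "bary x i = 0" using n by simp
  then show "bary x j = 0"
    using coords[OF ij(2)] ij n zero by (simp add: image_coord_def n_def[symmetric] field_simps)
qed

text \<open>On a face of codimension two the attractor has only vertices: if \<open>x = F\<^sub>l z\<close>, then \<open>l \<noteq> i, j\<close> and
  \<open>z\<^sub>l + z\<^sub>i = 1 = z\<^sub>l + z\<^sub>j\<close>, which with \<open>z\<^sub>l + z\<^sub>i + z\<^sub>j \<le> 1\<close> leaves only \<open>z\<^sub>l = 1\<close>.\<close>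

lemma attractor_vertex_if_two_bary_eq_0:
  assumes x: "x \<in> ifs.attractor" and ij: "i < k" "j < k" "i \<noteq> j"
    and zero: "bary x i = 0" "bary x j = 0"
  obtains l where "l < k" "x = p l"
proof -
  obtain l z where l: "l < k" and z: "z \<in> ifs.attractor" and xz: "x = simplex_map k p l z"
    using x ifs.attractor_invariant by blast
  have zs: "z \<in> solid_simplex" using z attractor_subset_solid_simplex by blast
  have ne: "l \<noteq> i" "l \<noteq> j" using bary_simplex_map_pos[OF zs l] zero xz by auto
  have "1 - bary z l - bary z i = 0" "1 - bary z l - bary z j = 0"
    using zero ij l ne k by (auto simp: xz bary_simplex_map image_coord_def)
  moreover have "bary z l + bary z i + bary z j \<le> 1"
    using bary_sum_le_1[OF zs, of "{l, i, j}"] ij l ne by (simp add: add_ac)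
  moreover have "0 \<le> bary z i" "0 \<le> bary z j" using zs ij by (auto simp: solid_simplex_def)
  ultimately have "bary z l = 1" by linarith
  then have "x = p l" using vertex_if_bary_eq_1[OF zs l] simplex_map_vertex[OF l] xz by simp
  with l show thesis by (rule that)
qed

section \<open>Codes of critical points\<close>

context
  fixes \<pi> :: "(nat \<Rightarrow> nat) \<Rightarrow> 'a"
  assumes \<pi>: "coding_map ifs.attractor {..<k} (simplex_map k p) \<pi>"
begin

lemma coding_map_mem: "range w \<subseteq> {..<k} \<Longrightarrow> \<pi> w \<in> ifs.attractor"
  using \<pi> by (auto simp: coding_map_def topspace_shift_space)

lemma coding_map_step:
  assumes "range w \<subseteq> {..<k}"
  shows "\<pi> w = simplex_map k p (w 0) (\<pi> (shift w))"
proof -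
  have "append_letter (w 0) (shift w) = w"
    by (auto simp: append_letter_def shift_def fun_eq_iff split: nat.splits)
  then show ?thesis
    using \<pi> range_word(1)[OF assms, of 0] range_word(2)[OF assms]
    unfolding coding_map_def topspace_shift_space by (metis mem_Collect_eq)
qed

text \<open>The coordinate \<open>m\<close> is positive on the \<open>m\<close>-th piece, so the last letter of a code of \<open>p l\<close> is \<open>l\<close>.
  By injectivity of the \<open>l\<close>-th map, the rest of the word is again a code of \<open>p l\<close>.\<close>

lemma code_of_vertex:
  assumes w: "range w \<subseteq> {..<k}" and l: "l < k" and eq: "\<pi> w = p l"
  shows "w = (\<lambda>_. l)"
proof -
  have step: "v 0 = l \<and> \<pi> (shift v) = p l" if v: "range v \<subseteq> {..<k}" and eq: "\<pi> v = p l" for v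
  proof -
    have v0: "v 0 < k" using range_word(1)[OF v, of 0] by simp
    have "\<pi> (shift v) \<in> solid_simplex"
      using coding_map_mem[OF range_word(2)[OF v]] attractor_subset_solid_simplex by blast
    then have "0 < bary (p l) (v 0)"
      using bary_simplex_map_pos v0 coding_map_step[OF v] eq by metis
    then have "v 0 = l" using l v0 by (simp add: bary_vertex split: if_splits)
    then have "simplex_map k p l (\<pi> (shift v)) = simplex_map k p l (p l)"
      using coding_map_step[OF v] eq simplex_map_vertex[OF l] by simp
    then show ?thesis using \<open>v 0 = l\<close> inj_simplex_map[OF l] by (simp add: inj_eq)
  qed
  have "\<pi> ((shift ^^ n) w) = p l" for n
  proof (induction n)
    case (Suc n)
    then show ?case using step[OF range_word(3)[OF w, of n]] by simp
  qed (simp add: eq)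
  then have "((shift ^^ n) w) 0 = l" for n using step[OF range_word(3)[OF w, of n]] by simp
  then show ?thesis by (simp add: funpow_shift fun_eq_iff)
qed

text \<open>A critical point lies in the piece named by the last letter \<open>m\<close> of its code and in the piece of
  some other letter \<open>j\<close>. Its preimage under the \<open>m\<close>-th map then has vanishing coordinates at \<open>m\<close> and
  \<open>j\<close>, hence is a vertex.\<close>

lemma shift_critical_code:
  assumes "w \<in> critical_set ifs.attractor {..<k} (simplex_map k p) \<pi>"
  obtains l where "l < k" "shift w = (\<lambda>_. l)"
proof -
  have w: "range w \<subseteq> {..<k}"
    using assms by (simp add: critical_set_def topspace_shift_space)
  define m x where "m = w 0" and "x = \<pi> (shift w)"
  have m: "m < k" using range_word(1)[OF w, of 0] by (simp add: m_def)
  have x: "x \<in> ifs.attractor" using coding_map_mem[OF range_word(2)[OF w]] by (simp add: x_def)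
  obtain i j where "i < k" "j < k" "i \<noteq> j" "\<pi> w \<in> simplex_map k p i ` ifs.attractor"
    "\<pi> w \<in> simplex_map k p j ` ifs.attractor"
    using assms by (auto simp: critical_set_def)
  \<comment> \<open>The two given pieces need not include the one of \<open>m\<close>, but they cannot both be it.\<close>
  then obtain j where j: "j < k" "m \<noteq> j" "\<pi> w \<in> simplex_map k p j ` ifs.attractor"
    by metis
  then obtain y where y: "y \<in> ifs.attractor" "\<pi> w = simplex_map k p j y" by blast
  have eq: "simplex_map k p m x = simplex_map k p j y"
    using coding_map_step[OF w] y by (simp add: m_def x_def)
  have "bary x m = 0" "bary x j = 0"
    using overlap_bary_eq_0[OF _ _ m j(1,2) eq] x y(1) attractor_subset_solid_simplex by blast+
  then obtain l where l: "l < k" "x = p l"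
    using attractor_vertex_if_two_bary_eq_0[OF x m j(1,2)] by blast
  then have "shift w = (\<lambda>_. l)"
    using code_of_vertex[OF range_word(2)[OF w]] by (simp add: x_def)
  with l(1) show thesis by (rule that)
qed

lemma finite_post_critical_set:
  "finite (post_critical_set ifs.attractor {..<k} (simplex_map k p) \<pi>)"
proof (rule finite_subset)
  show "post_critical_set ifs.attractor {..<k} (simplex_map k p) \<pi> \<subseteq> (\<lambda>l _. l) ` {..<k}"
  proof
    fix v assume "v \<in> post_critical_set ifs.attractor {..<k} (simplex_map k p) \<pi>"
    then obtain n w where w: "w \<in> critical_set ifs.attractor {..<k} (simplex_map k p) \<pi>"
      and v: "v = (shift ^^ Suc n) w"
      unfolding post_critical_set_def by (auto dest!: Suc_le_D)
    obtain l where l: "l < k" "shift w = (\<lambda>_. l)" using shift_critical_code[OF w] .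
    have "v = (shift ^^ n) (shift w)" unfolding v by (simp only: funpow_Suc_right o_apply)
    then have "v = (\<lambda>_. l)" by (simp add: l(2) funpow_shift)
    with l(1) show "v \<in> (\<lambda>l _. l) ` {..<k}" by blast
  qed
qed simp

end

end

theorem proposition5p7:
  fixes k :: nat and p :: "nat \<Rightarrow> 'a::euclidean_space"
  assumes "k \<ge> 3"
    and "DIM('a) = k - 1"
    and "regular_simplex_vertices k p"
  shows "post_critically_finite (simplex_attractor k p) {..<k} (simplex_map k p)"
proof -
  from assms(3) obtain d where inj: "inj_on p {..<k}" and indep: "\<not> affine_dependent (p ` {..<k})"
    and d: "\<forall>i<k. \<forall>j<k. i \<noteq> j \<longrightarrow> dist (p i) (p j) = d"
    unfolding regular_simplex_vertices_def by blast
  have "card (p ` {..<k}) = Suc DIM('a)" using inj assms(1,2) by (simp add: card_image)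
  with indep have span: "affine hull (p ` {..<k}) = UNIV" by (rule affine_independent_span_eq)
  interpret regular_simplex k p d
    using inj indep span d assms(1) by unfold_locales auto
  show ?thesis
    unfolding post_critically_finite_def simplex_attractor_eq
    using finite_post_critical_set ifs.self_similar_structure_attractor inj_simplex_map
    by (meson inj_on_subset lessThan_iff subset_UNIV)
qed

end
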